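(* Let $\rho>0$, $\beta>0$ and $\alpha\in[0,1)$. (a) The radius of starlikeness of order $\alpha$ of $f_{\rho,\beta}$ is $r^{\star}_{\alpha}(f_{\rho,\beta})=x_{\rho,\beta,1}$, where $x_{\rho,\beta,1}$ is the smallest positive zero of the equation (in $r$) $$r\lambda'_{\rho,\beta}(r)-(\alpha-1)\beta\lambda_{\rho,\beta}(r)=0.$$ (b) The radius of starlikeness of order $\alpha$ of $g_{\rho,\beta}$ is $r^{\star}_{\alpha}(g_{\rho,\beta})=y_{\rho,\beta,1}$, where $y_{\rho,\beta,1}$ is the smallest positive zero of the equation $$r\lambda'_{\rho,\beta}(r)-(\alpha-1)\lambda_{\rho,\beta}(r)=0.$$ (c) The radius of starlikeness of order $\alpha$ of $h_{\rho,\beta}$ is $r^{\star}_{\alpha}(h_{\rho,\beta})=z_{\rho,\beta,1}$, where $z_{\rho,\beta,1}$ is the smallest positive zero of the equation $$\sqrt{r}\,\lambda'_{\rho,\beta}(\sqrt{r})-2(\alpha-1)\lambda_{\rho,\beta}(\sqrt{r})=0.$$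
   Context: The Wright function is the entire function (of $z$) $\phi(\rho,\beta,z)=\sum_{n\ge 0}\frac{z^n}{n!\,\Gamma(n\rho+\beta)}$. Put $\lambda_{\rho,\beta}(z)=\phi(\rho,\beta,-z^2)$, and define $$f_{\rho,\beta}(z)=\left(z^{\beta}\Gamma(\beta)\phi(\rho,\beta,-z^2)\right)^{1/\beta},\quad g_{\rho,\beta}(z)=z\,\Gamma(\beta)\phi(\rho,\beta,-z^2),\quad h_{\rho,\beta}(z)=z\,\Gamma(\beta)\phi(\rho,\beta,-z).$$ Here $f_{\rho,\beta}$ is understood as $z\,(\Gamma(\beta)\phi(\rho,\beta,-z^2))^{1/\beta}$, analytic near $0$ with the branch of the power equal to $1$ at $z=0$, so that $f_{\rho,\beta}(0)=0$, $f_{\rho,\beta}'(0)=1$; consequently $zf_{\rho,\beta}'(z)/f_{\rho,\beta}(z)=1+\frac1\beta\, z\lambda'_{\rho,\beta}(z)/\lambda_{\rho,\beta}(z)$. For $r>0$ let $\mathbb{D}_r=\{z\in\mathbb{C}:|z|<r\}$. For an analytic $f$ normalized by $f(0)=f'(0)-1=0$ and $\alpha\in[0,1)$, the radius of starlikeness of order $\alpha$ is $$r^{\star}_{\alpha}(f)=\sup\left\{r>0:\ \operatorname{Re}\left(\frac{zf'(z)}{f(z)}\right)>\alpha\ \text{for all } z\in\mathbb{D}_r\right\}$$ (the quotient $zf'(z)/f(z)$ has value $1$ at $z=0$). *)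

theory Defs
  imports "HOL-Complex_Analysis.Complex_Analysis"
begin

definition wright :: "real \<Rightarrow> real \<Rightarrow> complex \<Rightarrow> complex" where
  "wright \<rho> \<beta> z = (\<Sum>n. z ^ n / (fact n * of_real (Gamma (real n * \<rho> + \<beta>))))"

definition wright_lambda :: "real \<Rightarrow> real \<Rightarrow> complex \<Rightarrow> complex" where
  "wright_lambda \<rho> \<beta> z = wright \<rho> \<beta> (- (z ^ 2))"

(* The base of the power is 1 at z = 0, so the principal power is the analytic branch with
   value 1 there. The principal power is only meant as the germ of f at 0: on larger discs
   the base may cross the cut, and the function intended there is the analytic continuation
   of this germ. The definition of starlike_radius takes care of that. *)
definition wright_f :: "real \<Rightarrow> real \<Rightarrow> complex \<Rightarrow> complex" where
  "wright_f \<rho> \<beta> z = z * (of_real (Gamma \<beta>) * wright \<rho> \<beta> (- (z ^ 2))) powr of_real (1 / \<beta>)"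

definition wright_g :: "real \<Rightarrow> real \<Rightarrow> complex \<Rightarrow> complex" where
  "wright_g \<rho> \<beta> z = z * of_real (Gamma \<beta>) * wright \<rho> \<beta> (- (z ^ 2))"

definition wright_h :: "real \<Rightarrow> real \<Rightarrow> complex \<Rightarrow> complex" where
  "wright_h \<rho> \<beta> z = z * of_real (Gamma \<beta>) * wright \<rho> \<beta> (- z)"

(* For f with f 0 = 0 and deriv f 0 = 1, the value at 0 is the removable one. At a zero
   z \<noteq> 0 of f the value is 0 (division by zero), so such a point
   violates Re (starlike_quot f z) > \<alpha> for every \<alpha> \<ge> 0. *)
definition starlike_quot :: "(complex \<Rightarrow> complex) \<Rightarrow> complex \<Rightarrow> complex" where
  "starlike_quot f z = (if z = 0 then 1 else z * deriv f z / f z)"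

(* Only the germ of f at 0 matters: F is its (unique) analytic continuation to the disc of
   radius r. For entire f this is the supremum for f itself, see starlike_radius_entire.
   Extended reals: an unbounded set of radii has supremum \<infinity>. *)
definition starlike_radius :: "real \<Rightarrow> (complex \<Rightarrow> complex) \<Rightarrow> ereal" where
  "starlike_radius \<alpha> f =
     Sup (ereal ` {r. r > 0 \<and>
       (\<exists>F. F holomorphic_on ball 0 r \<and> (\<forall>\<^sub>F z in nhds 0. F z = f z) \<and>
            (\<forall>z\<in>ball 0 r. Re (starlike_quot F z) > \<alpha>))})"

lemma starlike_radius_entire:
  assumes f: "f holomorphic_on UNIV"
  shows "starlike_radius \<alpha> f =
     Sup (ereal ` {r. r > 0 \<and> (\<forall>z\<in>ball 0 r. Re (starlike_quot f z) > \<alpha>)})"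
proof -
  have "(\<exists>F. F holomorphic_on ball 0 r \<and> (\<forall>\<^sub>F z in nhds 0. F z = f z) \<and>
            (\<forall>z\<in>ball 0 r. Re (starlike_quot F z) > \<alpha>)) \<longleftrightarrow>
        (\<forall>z\<in>ball 0 r. Re (starlike_quot f z) > \<alpha>)" (is "?L \<longleftrightarrow> ?R") if r: "r > 0" for r
  proof
    assume ?L
    then obtain F where F: "F holomorphic_on ball 0 r" "\<forall>\<^sub>F z in nhds 0. F z = f z"
      "\<forall>z\<in>ball 0 r. Re (starlike_quot F z) > \<alpha>" by blast
    from F(2) obtain S where S: "open S" "0 \<in> S" "\<And>z. z \<in> S \<Longrightarrow> F z = f z"
      unfolding eventually_nhds by blast
    have f': "f holomorphic_on ball 0 r" using f by (rule holomorphic_on_subset) simp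
    have ne: "S \<inter> ball 0 r \<noteq> {}"
      using S(2) r by (metis IntI centre_in_ball empty_iff)
    have eq: "F z = f z" if z: "z \<in> ball 0 r" for z
      by (rule analytic_continuation_open[OF open_Int[OF S(1) open_ball] open_ball ne
            connected_ball Int_lower2 F(1) f' _ z]) (simp add: S(3))
    have "starlike_quot F z = starlike_quot f z" if z: "z \<in> ball 0 r" for z
    proof -
      have "\<forall>\<^sub>F w in nhds z. F w = f w"
        using eventually_nhds_in_open[OF open_ball z] by (rule eventually_mono) (rule eq)
      then have "deriv F z = deriv f z" by (rule deriv_cong_ev) simp
      then show ?thesis using eq[OF z] by (simp add: starlike_quot_def)
    qed
    with F(3) show ?R by simp
  next
    assume ?R
    moreover have "f holomorphic_on ball 0 r" using f by (rule holomorphic_on_subset) simp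
    ultimately show ?L by (intro exI[of _ f] conjI) simp_all
  qed
  then show ?thesis unfolding starlike_radius_def
    by (intro arg_cong[where f = Sup] image_cong Collect_cong conj_cong refl) simp
qed

definition smallest_pos_zero :: "(real \<Rightarrow> complex) \<Rightarrow> real \<Rightarrow> bool" where
  "smallest_pos_zero E x \<longleftrightarrow> x > 0 \<and> E x = 0 \<and> (\<forall>r. 0 < r \<and> r < x \<longrightarrow> E r \<noteq> 0)"

end

theory Submission
  imports Defs "HOL-Computational_Algebra.Fundamental_Theorem_Algebra"
begin

text \<open>
  Put \<open>W(z) = \<Gamma>(\<beta>) \<phi>(\<rho>, \<beta>, -z)\<close>. Everything follows from the fact that the power series of
  \<open>T(z) = -z W'(z) / W(z)\<close> has nonnegative coefficients. For a polynomial \<open>P\<close> with \<open>P(0) = 1\<close> and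
  only positive roots, the coefficients of \<open>-z P' / P\<close> are power sums of the reciprocal roots, and
  \<open>P + z P' / c\<close> with \<open>c > 0\<close> again has only positive roots. Applying such operators to
  \<open>(1 - t z / N)^N\<close>, letting \<open>N\<close> tend to infinity and inserting the product formula for
  \<open>1 / \<Gamma>\<close> exhibits \<open>W\<close> as a coefficientwise limit of such polynomials (Laguerre's argument);
  coefficientwise convergence suffices, as each coefficient of \<open>-z P' / P\<close> is a polynomial in
  finitely many coefficients of \<open>P\<close>. Hence \<open>|T(z)| \<le> T(|z|)\<close> inside the zero-free disc, and on the
  positive axis \<open>T\<close> increases from \<open>0\<close> without bound, so it attains every level \<open>\<kappa> > 0\<close> exactly
  once before the first zero of \<open>W\<close>; that point is the radius of starlikeness.
\<close>

unbundle no vec_syntax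
unbundle fps_syntax

section \<open>Positivity of the logarithmic derivative\<close>

text \<open>Stated for formal series, so that limits may be taken coefficient by coefficient with no
  convergence of functions. Membership in the nonnegative reals says at once that the complex
  coefficient is real and has the right sign.\<close>

definition pos_log_deriv :: "complex fps \<Rightarrow> bool" where
  "pos_log_deriv A \<longleftrightarrow> A $ 0 = 1 \<and> (\<forall>k. (- fps_X * fps_deriv A * inverse A) $ k \<in> \<real>\<^sub>\<ge>\<^sub>0)"

lemma pos_log_deriv_1: "pos_log_deriv 1"
  by (simp add: pos_log_deriv_def)

text \<open>The logarithmic derivative turns products into sums.\<close>

lemma pos_log_deriv_mult:
  assumes "pos_log_deriv A" "pos_log_deriv B"
  shows "pos_log_deriv (A * B)"
proof -
  have nz: "A $ 0 \<noteq> 0" "B $ 0 \<noteq> 0" using assms by (auto simp: pos_log_deriv_def)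
  have "inverse A * A = 1" "inverse B * B = 1"
    using nz by (simp_all add: inverse_mult_eq_1)
  then have "- fps_X * fps_deriv (A * B) * inverse (A * B) =
        - fps_X * fps_deriv A * inverse A + - fps_X * fps_deriv B * inverse B"
    unfolding fps_inverse_mult fps_deriv_mult by algebra
  with assms show ?thesis
    unfolding pos_log_deriv_def by (auto simp only: fps_add_nth fps_mult_nth_0 mult_1 intro: nonneg_Reals_add_I)
qed

text \<open>Geometric series: \<open>- X A' / A\<close> is the sum of \<open>s ^ k X ^ k\<close>
  over \<open>k \<ge> 1\<close>.\<close>

lemma pos_log_deriv_linear:
  assumes "s > 0"
  shows "pos_log_deriv (1 - fps_const (of_real s) * fps_X)"
proof -
  let ?A = "1 - fps_const (of_real s :: complex) * fps_X"
  have "?A * Abs_fps (\<lambda>n. of_real s ^ n) = 1"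
  proof (rule fps_ext)
    fix n show "(?A * Abs_fps (\<lambda>n. of_real s ^ n)) $ n = (1 :: complex fps) $ n"
      by (cases n) (simp_all add: algebra_simps)
  qed
  then have inv: "inverse ?A = Abs_fps (\<lambda>n. of_real s ^ n)"
    by (rule fps_inverse_unique)
  have "- fps_X * fps_deriv ?A * inverse ?A = fps_X * (fps_const (of_real s) * Abs_fps (\<lambda>n. of_real s ^ n))"
    by (simp add: inv mult.assoc flip: fps_const_neg)
  moreover have "(fps_X * (fps_const (of_real s :: complex) * Abs_fps (\<lambda>n. of_real s ^ n))) $ k \<in> \<real>\<^sub>\<ge>\<^sub>0" for k
    using assms by (cases k) (simp_all flip: of_real_power of_real_mult)
  ultimately show ?thesis by (simp add: pos_log_deriv_def)
qed

text \<open>With constant term 1, the recursion for the coefficients of the inverse involves no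
  division: each is a polynomial in finitely many coefficients of the series, hence continuous in
  them.\<close>

lemma tendsto_fps_inverse_nth:
  fixes A :: "nat \<Rightarrow> complex fps"
  assumes A0: "\<And>m. A m $ 0 = 1" and B0: "B $ 0 = 1"
    and lim: "\<And>n. (\<lambda>m. A m $ n) \<longlonglongrightarrow> B $ n"
  shows "(\<lambda>m. inverse (A m) $ n) \<longlonglongrightarrow> inverse B $ n"
proof (induction n rule: less_induct)
  case (less n)
  show ?case
  proof (cases n)
    case 0
    then show ?thesis by (simp add: A0 B0)
  next
    case (Suc k)
    have rec: "inverse C $ n = - (\<Sum>i=1..n. C $ i * inverse C $ (n - i))"
      if "C $ 0 = 1" for C :: "complex fps"
      using that Suc by (simp add: fps_inverse_def)
    have "(\<lambda>m. - (\<Sum>i=1..n. A m $ i * inverse (A m) $ (n - i))) \<longlonglongrightarrow>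
        - (\<Sum>i=1..n. B $ i * inverse B $ (n - i))"
      using Suc by (intro tendsto_intros lim less) auto
    then show ?thesis by (simp only: rec[OF A0] rec[OF B0])
  qed
qed

text \<open>Each coefficient of the logarithmic derivative is a finite sum of products of convergent
  coefficients, and the nonnegative reals form a closed set.\<close>

lemma pos_log_deriv_limit:
  assumes A: "\<And>m. pos_log_deriv (A m)"
    and lim: "\<And>n. (\<lambda>m. A m $ n) \<longlonglongrightarrow> B $ n"
  shows "pos_log_deriv B"
proof -
  have A0: "A m $ 0 = 1" for m using A by (simp add: pos_log_deriv_def)
  have B0: "B $ 0 = 1" using lim[of 0] by (simp add: A0 LIMSEQ_const_iff)
  have "(- fps_X * fps_deriv B * inverse B) $ k \<in> \<real>\<^sub>\<ge>\<^sub>0" for k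
  proof -
    have xd: "(- fps_X * fps_deriv C) $ i = - of_nat i * C $ i" for C :: "complex fps" and i
      by (cases i) (simp_all add: algebra_simps)
    have "(\<lambda>m. (- fps_X * fps_deriv (A m) * inverse (A m)) $ k) \<longlonglongrightarrow>
        (- fps_X * fps_deriv B * inverse B) $ k"
      unfolding fps_mult_nth[of "- fps_X * _"] xd
      by (intro tendsto_intros lim tendsto_fps_inverse_nth A0 B0)
    then show ?thesis
      using A by (intro Lim_in_closed_set[OF closed_nonneg_Reals_complex])
        (auto simp: pos_log_deriv_def)
  qed
  with B0 show ?thesis by (simp add: pos_log_deriv_def)
qed

section \<open>Polynomials with positive roots and their multipliers\<close>

definition pos_rooted :: "complex poly \<Rightarrow> bool" where
  "pos_rooted p \<longleftrightarrow> coeff p 0 = 1 \<and> (\<forall>z. poly p z = 0 \<longrightarrow> (\<exists>s>0. z = of_real s))"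

text \<open>By the fundamental theorem of algebra a nonconstant polynomial splits off a linear
  factor. The parameter \<open>s\<close> is the reciprocal of the root, which keeps all constant
  coefficients equal to 1.\<close>

lemma pos_rooted_induct [consumes 1, case_names one linear]:
  assumes "pos_rooted p" and one: "P 1"
    and lin: "\<And>s q. s > 0 \<Longrightarrow> pos_rooted q \<Longrightarrow> P q \<Longrightarrow> P ([:1, - of_real s:] * q)"
  shows "P p"
  using assms(1)
proof (induction "degree p" arbitrary: p rule: less_induct)
  case less
  have p0: "coeff p 0 = 1" using less.prems by (simp add: pos_rooted_def)
  show ?case
  proof (cases "degree p = 0")
    case True
    then obtain a where "p = [:a:]" by (auto elim: degree_eq_zeroE)
    with p0 have "p = 1" by (simp add: one_pCons)
    with one show ?thesis by simp
  next
    case False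
    then have "\<not> constant (poly p)" by (simp add: constant_degree)
    then obtain z where z: "poly p z = 0"
      using fundamental_theorem_of_algebra by blast
    with less.prems obtain r where r: "r > 0" "z = of_real r"
      by (auto simp: pos_rooted_def)
    from z obtain q where q: "p = [:- z, 1:] * q" by (auto simp: poly_eq_0_iff_dvd)
    \<comment> \<open>Moves the scalar \<open>- z\<close> to the cofactor:
      \<open>(X - z) q = (1 - X / z) (- z q)\<close>.\<close>
    define q' where "q' = smult (- z) q"
    have pq': "p = [:1, - of_real (1 / r):] * q'"
      using r by (simp add: q q'_def smult_add_right poly_eq_iff coeff_pCons split: nat.split)
    have "q' \<noteq> 0" using False pq' by auto
    then have deg: "degree p = Suc (degree q')"
      unfolding pq' by (subst degree_mult_eq) (use r in auto)
    have q'p: "pos_rooted q'"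
      using less.prems p0 unfolding pos_rooted_def pq' by (auto simp: coeff_mult)
    have "P ([:1, - of_real (1 / r):] * q')"
      using r deg q'p by (intro lin less.hyps) auto
    then show ?thesis unfolding pq'[symmetric] .
  qed
qed

lemma pos_log_deriv_pos_rooted:
  assumes "pos_rooted p"
  shows "pos_log_deriv (fps_of_poly p)"
  using assms
proof (induction rule: pos_rooted_induct)
  case one
  show ?case by (simp add: pos_log_deriv_1)
next
  case (linear s q)
  have "fps_of_poly [:1, - complex_of_real s:] = 1 - fps_const (of_real s) * fps_X"
    by (simp add: fps_of_poly_linear' flip: fps_const_neg)
  with linear show ?case
    by (simp only: fps_of_poly_mult pos_log_deriv_mult pos_log_deriv_linear)
qed

text \<open>The set described in the conclusion is closed under addition and misses the negative reals.\<close>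
lemma pos_rooted_log_deriv_cone:
  assumes "pos_rooted p" and z: "\<nexists>s. s > 0 \<and> z = of_real s"
  defines "w \<equiv> z * poly (pderiv p) z / poly p z"
  shows "if Im z = 0 then Re w \<ge> 0 else w = 0 \<or> Im w * Im z < 0"
  using assms(1) unfolding w_def
proof (induction rule: pos_rooted_induct)
  case one
  show ?case by simp
next
  case (linear s q)
  define l where "l = [:1, - complex_of_real s:]"
  define v where "v = z * poly (pderiv q) z / poly q z"
  \<comment> \<open>The contribution of the linear factor to the logarithmic derivative;
    \<open>v\<close> is that of the remaining factors.\<close>
  define u where "u = - of_real s * z / (1 - of_real s * z)"
  have qz: "poly q z \<noteq> 0" using linear z by (auto simp: pos_rooted_def)
  have lz: "1 - of_real s * z \<noteq> 0"
  proof
    assume "1 - of_real s * z = 0"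
    then have "z = of_real (1 / s)" using linear by (auto simp: field_simps)
    moreover have "1 / s > 0" using linear by simp
    ultimately show False using z by blast
  qed
  have uv: "z * poly (pderiv (l * q)) z / poly (l * q) z = u + v"
  proof -
    have "poly l z = 1 - of_real s * z" "poly (pderiv l) z = - of_real s"
      by (simp_all add: l_def pderiv_pCons)
    then show ?thesis
      using qz lz unfolding u_def v_def pderiv_mult by (simp add: divide_simps) (simp add: algebra_simps)
  qed
  have u: "if Im z = 0 then Re u \<ge> 0 else Im u * Im z < 0"
  proof -
    \<comment> \<open>The squared modulus of the denominator of \<open>u\<close>, which gives real
      and imaginary part of \<open>u\<close> in closed form.\<close>
    define d where "d = (1 - s * Re z)\<^sup>2 + (s * Im z)\<^sup>2"
    have d: "d > 0"
    proof -
      have "d = (cmod (1 - of_real s * z))\<^sup>2" by (simp add: d_def cmod_power2)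
      with lz show ?thesis by simp
    qed
    have Re: "Re u = (- s * Re z * (1 - s * Re z) + (s * Im z)\<^sup>2) / d"
      unfolding u_def Re_divide d_def
      by (rule arg_cong2[where f = "(/)"]) (simp_all add: algebra_simps power2_eq_square)
    have Im: "Im u = - s * Im z / d"
      unfolding u_def Im_divide d_def
      by (rule arg_cong2[where f = "(/)"]) (simp_all add: algebra_simps power2_eq_square)
    show ?thesis
    proof (cases "Im z = 0")
      case True
      then have "Re z \<le> 0" using z by (metis complex_eq_iff Re_complex_of_real Im_complex_of_real not_le)
      then have "s * Re z \<le> 0" using linear by (simp add: mult_nonneg_nonpos)
      then have "- (s * Re z) * (1 - s * Re z) \<ge> 0"
        by (intro mult_nonneg_nonneg) linarith+
      then show ?thesis using True d by (simp add: Re divide_le_0_iff)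
    next
      case False
      then have "s * (Im z)\<^sup>2 / d > 0" using linear d by simp
      then show ?thesis using False by (simp add: Im power2_eq_square)
    qed
  qed
  have v: "if Im z = 0 then Re v \<ge> 0 else v = 0 \<or> Im v * Im z < 0"
    using linear unfolding v_def by simp
  have "if Im z = 0 then Re (u + v) \<ge> 0 else u + v = 0 \<or> Im (u + v) * Im z < 0"
  proof (cases "Im z = 0")
    case True
    with u v show ?thesis by simp
  next
    case False
    \<comment> \<open>The strict sign from the new factor survives even if \<open>v = 0\<close>,
      which is the case of the constant polynomial.\<close>
    with u v have "Im u * Im z < 0" "Im v * Im z \<le> 0" by auto
    then have "Im (u + v) * Im z < 0" unfolding plus_complex.sel distrib_right by linarith
    with False show ?thesis by simp
  qed
  then show ?case unfolding uv[symmetric] l_def .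
qed

text \<open>Away from the positive axis \<open>p\<close> does not vanish, so a root of
  \<open>p + z p' / c\<close> there would satisfy \<open>z p' / p = - c\<close>. The cone property
  excludes this negative real value.\<close>

lemma pos_rooted_shift_euler:
  assumes p: "pos_rooted p" and c: "c > 0"
  shows "pos_rooted (p + smult (of_real (1 / c)) (pCons 0 (pderiv p)))"
  unfolding pos_rooted_def
proof (intro conjI allI impI)
  show "coeff (p + smult (of_real (1 / c)) (pCons 0 (pderiv p))) 0 = 1"
    using p by (simp add: pos_rooted_def)
  fix z assume z: "poly (p + smult (of_real (1 / c)) (pCons 0 (pderiv p))) z = 0"
  show "\<exists>s>0. z = of_real s"
  proof (rule ccontr)
    assume neg: "\<not> (\<exists>s>0. z = of_real s)"
    then have nz: "poly p z \<noteq> 0" using p by (auto simp: pos_rooted_def)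
    then have "z * poly (pderiv p) z / poly p z = of_real (- c)"
      using z c by (simp add: field_simps eq_neg_iff_add_eq_0)
    with pos_rooted_log_deriv_cone[OF p, of z] neg c show False
      by (auto split: if_splits)
  qed
qed

text \<open>The operator \<open>p + z p' / c\<close> multiplies the coefficient of index
  \<open>n\<close> by \<open>(n + c) / c\<close>; it is applied successively with the constants
  \<open>c j\<close>.\<close>

lemma pos_rooted_multiplier:
  fixes c :: "nat \<Rightarrow> real"
  assumes "pos_rooted p" and c: "\<And>j. c j > 0"
  shows "\<exists>q. pos_rooted q \<and> (\<forall>n. coeff q n = coeff p n * of_real (\<Prod>j<m. (real n + c j) / c j))"
proof (induction m)
  case 0
  show ?case using assms(1) by auto
next
  case (Suc m)
  then obtain q where q: "pos_rooted q"
    "\<And>n. coeff q n = coeff p n * of_real (\<Prod>j<m. (real n + c j) / c j)" by auto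
  have "coeff (q + smult (of_real (1 / c m)) (pCons 0 (pderiv q))) n =
      coeff q n * of_real ((real n + c m) / c m)" for n
    using c[of m] by (cases n) (simp_all add: coeff_pderiv field_simps)
  with pos_rooted_shift_euler[OF q(1) c[of m]] show ?case
    by (intro exI[of _ "q + smult (of_real (1 / c m)) (pCons 0 (pderiv q))"])
      (simp add: q(2) mult.assoc)
qed

section \<open>From polynomials to the exponential and Wright series\<close>

lemma binomial_div_power_tendsto:
  "(\<lambda>N. of_nat (N choose n) / of_nat N ^ n :: complex) \<longlonglongrightarrow> 1 / fact n"
proof -
  have "(\<lambda>N. (\<Prod>i<n. 1 - of_nat i / of_nat N :: complex) / fact n) \<longlonglongrightarrow> (\<Prod>i<n. 1 - 0) / fact n"
    by (intro tendsto_intros tendsto_divide_0[OF tendsto_const] tendsto_of_nat) auto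
  moreover have "\<forall>\<^sub>F N in sequentially. (\<Prod>i<n. 1 - of_nat i / of_nat N :: complex) / fact n =
      of_nat (N choose n) / of_nat N ^ n"
    using eventually_gt_at_top[of 0]
  proof eventually_elim
    case (elim N)
    have "of_nat (N choose n) / of_nat N ^ n =
        (\<Prod>i<n. of_nat N - of_nat i :: complex) / (\<Prod>i<n. of_nat N) / fact n"
      by (simp add: binomial_gbinomial gbinomial_prod_rev lessThan_atLeast0)
    also have "\<dots> = (\<Prod>i<n. 1 - of_nat i / of_nat N) / fact n"
      unfolding prod_dividef[symmetric] using elim by (simp add: diff_divide_distrib)
    finally show ?case by simp
  qed
  ultimately show ?thesis by (auto intro: Lim_transform_eventually)
qed

text \<open>The polynomials \<open>(1 - t z / N) ^ N\<close> have only positive roots and tend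
  coefficientwise to \<open>exp (- t z)\<close>; the finitely many multipliers commute with this
  limit.\<close>

lemma pos_log_deriv_exp_multiplier:
  fixes c :: "nat \<Rightarrow> real"
  assumes c: "\<And>j. c j > 0" and t: "t > 0"
  shows "pos_log_deriv (Abs_fps (\<lambda>n. (- of_real t) ^ n / fact n *
           of_real (\<Prod>j<m. (real n + c j) / c j)))"
proof -
  \<comment> \<open>Using \<open>Suc N\<close> instead of \<open>N\<close> avoids division by
    zero.\<close>
  define p where "p N = [:1, - complex_of_real (t / Suc N):] ^ Suc N" for N
  have pr: "pos_rooted (p N)" for N
  proof -
    have "coeff (p N) 0 = 1" by (simp add: p_def coeff_0_power del: power_Suc)
    moreover have "\<exists>s>0. z = of_real s" if "poly (p N) z = 0" for z
    proof -
      have "z = of_real (Suc N / t)" using that t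
        by (simp add: p_def poly_power field_simps del: power_Suc)
      with t show ?thesis by (intro exI[of _ "Suc N / t"]) simp
    qed
    ultimately show ?thesis by (auto simp: pos_rooted_def)
  qed
  have "\<exists>q. \<forall>N. pos_rooted (q N) \<and>
      (\<forall>n. coeff (q N) n = coeff (p N) n * of_real (\<Prod>j<m. (real n + c j) / c j))"
    by (intro choice allI pos_rooted_multiplier pr c)
  then obtain q where q: "\<And>N. pos_rooted (q N)"
    "\<And>N n. coeff (q N) n = coeff (p N) n * of_real (\<Prod>j<m. (real n + c j) / c j)" by blast
  show ?thesis
  proof (rule pos_log_deriv_limit)
    show "pos_log_deriv (fps_of_poly (q N))" for N
      by (rule pos_log_deriv_pos_rooted[OF q(1)])
    fix n
    have coeff: "coeff (p N) n = (- of_real t) ^ n * (of_nat (Suc N choose n) / of_nat (Suc N) ^ n)" for N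
    proof -
      have "- complex_of_real (t / Suc N) = (- of_real t) / of_nat (Suc N)" by simp
      then have "coeff (p N) n = of_nat (Suc N choose n) * ((- of_real t) / of_nat (Suc N)) ^ n"
      proof (cases "n \<le> Suc N")
        case True
        then show ?thesis
          unfolding p_def by (simp only: coeff_linear_poly_power \<open>_ = (- of_real t) / of_nat (Suc N)\<close>) simp
      next
        case False
        have "degree (p N) \<le> degree [:1, - complex_of_real (t / Suc N):] * Suc N"
          unfolding p_def by (rule degree_power_le)
        also have "\<dots> < n" using False by auto
        finally show ?thesis using False by (simp add: coeff_eq_0)
      qed
      then show ?thesis by (simp only: power_divide times_divide_eq_right mult.commute)
    qed
    show "(\<lambda>N. fps_of_poly (q N) $ n) \<longlonglongrightarrow>
        Abs_fps (\<lambda>n. (- of_real t) ^ n / fact n * of_real (\<Prod>j<m. (real n + c j) / c j)) $ n"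
      using tendsto_mult_right[OF tendsto_mult_left[OF LIMSEQ_Suc[OF binomial_div_power_tendsto[of n]]]]
      unfolding fps_of_poly_nth q(2) coeff fps_nth_Abs_fps by (simp only: times_divide_eq_right mult_1_right)
  qed
qed

lemma pos_log_deriv_wright:
  assumes \<rho>: "\<rho> > 0" and \<beta>: "\<beta> > 0"
  shows "pos_log_deriv (Abs_fps (\<lambda>n. (- 1) ^ n / fact n *
           of_real (Gamma \<beta> / Gamma (real n * \<rho> + \<beta>))))"
proof (rule pos_log_deriv_limit)
  \<comment> \<open>With this choice the product of the multipliers is a quotient of Pochhammer
    symbols at \<open>n \<rho> + \<beta>\<close> and \<open>\<beta>\<close>. It grows like
    \<open>m\<close> to the power \<open>n \<rho>\<close>, and rescaling the variable by
    \<open>t m\<close>, which is \<open>m\<close> to the power \<open>- \<rho>\<close>, compensates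
    exactly.\<close>
  define c where "c j = (\<beta> + real j) / \<rho>" for j
  define t where "t m = exp (- \<rho> * ln (real m))" for m
  show "pos_log_deriv (Abs_fps (\<lambda>n. (- of_real (t m)) ^ n / fact n *
           of_real (\<Prod>j<Suc m. (real n + c j) / c j)))" for m
    by (rule pos_log_deriv_exp_multiplier) (use assms in \<open>auto simp: c_def t_def add_pos_nonneg\<close>)
  fix n
  \<comment> \<open>The factorials in the two series for \<open>1 / \<Gamma>\<close> cancel; the
    powers of \<open>m\<close> that remain are \<open>t m ^ n\<close>.\<close>
  have *: "t m ^ n * (\<Prod>j<Suc m. (real n + c j) / c j) =
      rGamma_series (real n * \<rho> + \<beta>) m / rGamma_series \<beta> m" for m
  proof -
    have "(real n + c j) / c j = (real n * \<rho> + \<beta> + real j) / (\<beta> + real j)" for j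
    proof -
      have cj: "\<beta> + real j = c j * \<rho>" using \<rho> by (simp add: c_def)
      show ?thesis using \<rho> unfolding add.assoc cj distrib_right[symmetric] by simp
    qed
    then have poch: "(\<Prod>j<Suc m. (real n + c j) / c j) =
        pochhammer (real n * \<rho> + \<beta>) (Suc m) / pochhammer \<beta> (Suc m)"
      by (simp only: pochhammer_prod prod_dividef lessThan_atLeast0)
    have E: "exp ((real n * \<rho> + \<beta>) * ln (real m)) * t m ^ n = exp (\<beta> * ln (real m))"
      by (simp add: t_def algebra_simps flip: exp_of_nat_mult exp_add)
    have "rGamma_series (real n * \<rho> + \<beta>) m / rGamma_series \<beta> m =
        pochhammer (real n * \<rho> + \<beta>) (Suc m) / pochhammer \<beta> (Suc m) *
        (exp (\<beta> * ln (real m)) / exp ((real n * \<rho> + \<beta>) * ln (real m)))"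
      by (simp add: rGamma_series_def)
    then show ?thesis unfolding poch E[symmetric] by simp
  qed
  have "(\<lambda>m. rGamma_series (real n * \<rho> + \<beta>) m / rGamma_series \<beta> m) \<longlonglongrightarrow>
      rGamma (real n * \<rho> + \<beta>) / rGamma \<beta>"
    using Gamma_real_pos[OF \<beta>] by (intro tendsto_intros) (simp add: rGamma_inverse_Gamma)
  then have "(\<lambda>m. t m ^ n * (\<Prod>j<Suc m. (real n + c j) / c j)) \<longlonglongrightarrow> 
      Gamma \<beta> / Gamma (real n * \<rho> + \<beta>)"
    by (simp only: * rGamma_inverse_Gamma) (simp add: field_simps)
  then have "(\<lambda>m. (-1) ^ n / fact n * complex_of_real (t m ^ n * (\<Prod>j<Suc m. (real n + c j) / c j)))
      \<longlonglongrightarrow> (- 1) ^ n / fact n * of_real (Gamma \<beta> / Gamma (real n * \<rho> + \<beta>))"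
    by (intro tendsto_intros)
  moreover have "(-1) ^ n / fact n * complex_of_real (t m ^ n * (\<Prod>j<Suc m. (real n + c j) / c j)) =
     (- of_real (t m)) ^ n / fact n * of_real (\<Prod>j<Suc m. (real n + c j) / c j)" for m
    by (subst power_minus) (simp del: prod.lessThan_Suc)
  ultimately show "(\<lambda>m. Abs_fps (\<lambda>n. (- complex_of_real (t m)) ^ n / fact n *
           of_real (\<Prod>j<Suc m. (real n + c j) / c j)) $ n) \<longlonglongrightarrow>
      Abs_fps (\<lambda>n. (- 1) ^ n / fact n * of_real (Gamma \<beta> / Gamma (real n * \<rho> + \<beta>))) $ n"
    by (simp only: fps_nth_Abs_fps)
qed

section \<open>Level points of the logarithmic derivative\<close>

text \<open>A bounded logarithmic derivative amounts to a linear differential inequality along the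
  radius towards \<open>w\<close>. As in Gronwall's lemma, a function that obeys it and vanishes at
  \<open>w\<close> vanishes nearby, against \<open>nz\<close>.\<close>

lemma log_deriv_unbounded_at_zero:
  fixes V :: "complex \<Rightarrow> complex"
  assumes hol: "V holomorphic_on UNIV" and R: "R > 0" "norm w = R" and w: "V w = 0"
    and bd: "\<And>z. norm z < R \<Longrightarrow> norm (z * deriv V z) \<le> K * norm (V z)"
    and nz: "\<And>z. norm z < R \<Longrightarrow> V z \<noteq> 0"
  shows False
proof -
  \<comment> \<open>At the origin the bound reads \<open>0 \<le> K * norm (V 0)\<close>.\<close>
  have K: "K \<ge> 0"
    using bd[of 0] nz[of 0] R by (simp add: zero_le_mult_iff)
  have cont: "continuous_on A V" "continuous_on A (deriv V)" for A
    using holomorphic_on_imp_continuous_on[OF hol]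
      holomorphic_on_imp_continuous_on[OF holomorphic_deriv[OF hol open_UNIV]]
    by (auto intro: continuous_on_subset)
  have bd': "norm (z * deriv V z) \<le> K * norm (V z)" if "z \<in> closure (ball 0 R)" for z
  proof -
    have "norm (z * deriv V z) - K * norm (V z) \<le> 0"
      by (rule continuous_le_on_closure[OF _ that])
        (use bd in \<open>auto intro!: continuous_intros cont\<close>)
    then show ?thesis by simp
  qed
  have cb: "closure (ball 0 R) = (cball 0 R :: complex set)" using R by simp
  \<comment> \<open>The mean value inequality on a short radial segment ending at the zero forces \<open>V\<close> to vanish on it.\<close>
  define e where "e = 1 / (2 + 4 * K)"
  \<comment> \<open>The second bound keeps the segment outside radius \<open>R / 2\<close>, so that
    \<open>V'\<close> is controlled by \<open>2 K / R\<close> times \<open>V\<close>; the third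
    makes the final estimate a strict contraction.\<close>
  have e: "0 < e" "e \<le> 1 / 2" "2 * K * e < 1"
    using K by (auto simp: e_def field_simps)
  define p where "p = of_real (1 - e) * w"
  define S where "S = closed_segment p w"
  have S: "R / 2 \<le> norm z \<and> norm z \<le> R \<and> norm (z - w) \<le> e * R" if zS: "z \<in> S" for z
  proof -
    from zS obtain u where u: "0 \<le> u" "u \<le> 1" "z = (1 - u) *\<^sub>R p + u *\<^sub>R w"
      by (auto simp: S_def in_segment)
    have z: "z = of_real (1 - (1 - u) * e) * w"
      by (simp add: u(3) p_def scaleR_conv_of_real algebra_simps)
    have ue: "0 \<le> (1 - u) * e" "(1 - u) * e \<le> e"
      using u e by (auto intro: mult_left_le_one_le)
    have "norm z = (1 - (1 - u) * e) * R"
    proof -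
      have "\<bar>1 - (1 - u) * e\<bar> = 1 - (1 - u) * e" using ue e by linarith
      then show ?thesis using R by (simp add: z norm_mult del: of_real_diff of_real_mult)
    qed
    moreover have "norm (z - w) = (1 - u) * e * R"
    proof -
      have "z - w = - of_real ((1 - u) * e) * w" by (simp add: z algebra_simps)
      then show ?thesis using ue R by (simp add: norm_mult del: of_real_mult of_real_diff)
    qed
    moreover have "(1 / 2) * R \<le> (1 - (1 - u) * e) * R" "(1 - (1 - u) * e) * R \<le> 1 * R"
      "(1 - u) * e * R \<le> e * R"
      by (intro mult_right_mono; use ue e R in linarith)+
    ultimately show ?thesis by simp
  qed
  have "compact S" "S \<noteq> {}" by (auto simp: S_def)
  moreover have "continuous_on S (\<lambda>z. norm (V z))" by (intro continuous_intros cont)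
  ultimately obtain q where q: "q \<in> S" "\<And>z. z \<in> S \<Longrightarrow> norm (V z) \<le> norm (V q)"
    using continuous_attains_sup[of S "\<lambda>z. norm (V z)"] by blast
  \<comment> \<open>At the maximum point \<open>q\<close>, with \<open>V w = 0\<close>, this yields
    \<open>norm (V q) \<le> 2 K e * norm (V q)\<close>, hence \<open>V q = 0\<close>.\<close>
  have "norm (V q - V w) \<le> (2 * K / R * norm (V q)) * norm (q - w)"
  proof (rule field_differentiable_bound[of S])
    show "convex S" by (simp add: S_def)
    show "(V has_field_derivative deriv V z) (at z within S)" for z
      using holomorphic_derivI[OF hol open_UNIV] by (auto intro: has_field_derivative_at_within)
    show "norm (deriv V z) \<le> 2 * K / R * norm (V q)" if "z \<in> S" for z
    proof -
      have "R / 2 * norm (deriv V z) \<le> norm z * norm (deriv V z)"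
        using S[OF that] by (intro mult_right_mono) auto
      also have "\<dots> \<le> K * norm (V z)"
        using bd'[of z] S[OF that] unfolding cb by (simp add: norm_mult)
      also have "\<dots> \<le> K * norm (V q)" using q(2)[OF that] K by (rule mult_left_mono)
      finally show ?thesis using R by (simp add: field_simps)
    qed
  qed (use q in \<open>auto simp: S_def\<close>)
  also have "\<dots> \<le> (2 * K / R * norm (V q)) * (e * R)"
    using S[OF q(1)] K R by (intro mult_left_mono) auto
  also have "\<dots> = (2 * K * e) * norm (V q)" using R by simp
  finally have "(1 - 2 * K * e) * norm (V q) \<le> 0" using w by (simp add: algebra_simps)
  then have "V q = 0" using e by (simp add: mult_le_0_iff)
  moreover have "p \<in> S" by (simp add: S_def)
  ultimately have "V p = 0" using q(2) by fastforce
  moreover have "norm p < R" using e R by (simp add: p_def norm_mult del: of_real_diff)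
  ultimately show False using nz by blast
qed

text \<open>\<open>T\<close> is holomorphic on the zero-free disc, so its Taylor series converges
  there, and its coefficients are nonnegative. All three claims are read off termwise; the third
  gives a strictly positive growth rate on the positive axis when the linear coefficient of
  \<open>A\<close> is nonzero.\<close>

lemma
  assumes hol: "V holomorphic_on UNIV" and exp: "V has_fps_expansion A" and A: "pos_log_deriv A"
    and nz: "\<And>z. norm z < R \<Longrightarrow> V z \<noteq> 0"
  defines "T \<equiv> \<lambda>z. - z * deriv V z / V z"
  assumes r: "r < R"
  shows log_deriv_nonneg: "0 \<le> r \<Longrightarrow> T (of_real r) \<in> \<real>\<^sub>\<ge>\<^sub>0"
    and norm_log_deriv_le: "norm w \<le> r \<Longrightarrow> norm (T w) \<le> Re (T (of_real r))"
    and log_deriv_increment: "0 \<le> s \<Longrightarrow> s \<le> r \<Longrightarrow>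
      - Re (A $ 1) * (r - s) \<le> Re (T (of_real r)) - Re (T (of_real s))"
proof -
  define S where "S = - fps_X * fps_deriv A * inverse A"
  define a where "a n = Re (S $ n)" for n
  have A0: "A $ 0 = 1" using A by (simp add: pos_log_deriv_def)
  have S: "S $ n = of_real (a n)" "a n \<ge> 0" for n
    using A unfolding pos_log_deriv_def S_def[symmetric] a_def
    by (auto simp: complex_nonneg_Reals_iff complex_eq_iff)
  have "S $ 1 = - A $ 1"
    by (simp add: S_def mult.assoc fps_mult_nth_0 A0)
  then have a1: "a 1 = - Re (A $ 1)" by (simp add: a_def)
  have holT: "T holomorphic_on eball 0 (ereal R)"
    unfolding T_def
    by (intro holomorphic_intros holomorphic_on_subset[OF hol]
          holomorphic_on_subset[OF holomorphic_deriv[OF hol open_UNIV]]) (auto dest: nz)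
  have "T has_fps_expansion S"
    unfolding T_def S_def divide_inverse
    by (intro fps_expansion_intros exp) (simp add: A0)
  then have sumsT: "(\<lambda>n. of_real (a n) * z ^ n) sums T z" if "norm z < R" for z
    using has_fps_expansion_imp_sums_complex[OF _ holT, of S z] that by (simp add: S)
  have sumsr: "(\<lambda>n. of_real (a n * u ^ n)) sums T (of_real u)" if "0 \<le> u" "u < R" for u
    using sumsT[of "of_real u"] that by simp
  have Re: "(\<lambda>n. a n * u ^ n) sums Re (T (of_real u))" if "0 \<le> u" "u < R" for u
    using sums_Re[OF sumsr[OF that]] by simp
  show "T (of_real r) \<in> \<real>\<^sub>\<ge>\<^sub>0" if "0 \<le> r"
  proof -
    have "(\<lambda>n. 0) sums Im (T (of_real r))"
      using sums_Im[OF sumsr[OF that r]] by simp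
    then have "Im (T (of_real r)) = 0" using sums_unique2[OF _ sums_zero] by blast
    moreover have "Re (T (of_real r)) \<ge> 0"
      by (rule sums_le[OF _ sums_zero Re[OF that r]]) (use S(2) that in auto)
    ultimately show ?thesis by (simp add: complex_nonneg_Reals_iff)
  qed
  show "norm (T w) \<le> Re (T (of_real r))" if w: "norm w \<le> r"
  proof -
    have r0: "0 \<le> r" using w norm_ge_zero[of w] by linarith
    have "norm (\<Sum>n. of_real (a n) * w ^ n) \<le> (\<Sum>n. a n * r ^ n)"
    proof (rule norm_suminf_le)
      show "norm (of_real (a n) * w ^ n) \<le> a n * r ^ n" for n
        using S(2)[of n] w by (simp add: norm_mult norm_power mult_left_mono power_mono)
      show "summable (\<lambda>n. a n * r ^ n)" using Re[OF r0 r] by (rule sums_summable)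
    qed
    then show ?thesis using sumsT[of w] Re[OF r0 r] w r by (simp add: sums_iff)
  qed
  show "- Re (A $ 1) * (r - s) \<le> Re (T (of_real r)) - Re (T (of_real s))" if s: "0 \<le> s" "s \<le> r"
  proof -
    have d: "(\<lambda>n. a n * r ^ n - a n * s ^ n) sums (Re (T (of_real r)) - Re (T (of_real s)))"
      using s r by (intro sums_diff Re) auto
    \<comment> \<open>For \<open>s \<le> r\<close> all terms are nonnegative, so the term of index 1
      alone is a lower bound.\<close>
    have "(\<Sum>n\<in>{1}. a n * r ^ n - a n * s ^ n) \<le> (\<Sum>n. a n * r ^ n - a n * s ^ n)"
      using s S(2) by (intro sum_le_suminf sums_summable[OF d]) (auto intro!: mult_left_mono power_mono)
    then show ?thesis using sums_unique[OF d] unfolding a1[symmetric] by (simp add: algebra_simps)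
  qed
qed

text \<open>\<open>T\<close> vanishes at 0 and reaches \<open>k\<close> on the positive axis inside
  a zero-free disc, so the intermediate value theorem supplies \<open>x\<close>. Domination of
  \<open>T z\<close> by \<open>T\<close> at \<open>norm z\<close>, together with strict growth,
  keeps the real part below \<open>k\<close> inside the disc.\<close>

lemma ex_log_deriv_level:
  assumes hol: "V holomorphic_on UNIV" and exp: "V has_fps_expansion A" and A: "pos_log_deriv A"
    and A1: "A $ 1 \<noteq> 0" and k: "k > 0"
  shows "\<exists>x>0. (\<forall>z\<in>cball 0 x. V z \<noteq> 0) \<and>
           - of_real x * deriv V (of_real x) / V (of_real x) = of_real k \<and>
           (\<forall>z\<in>ball 0 x. Re (- z * deriv V z / V z) < k)"
proof -
  define T where "T z = - z * deriv V z / V z" for z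
  define a where "a = - Re (A $ 1)"
  have A0: "A $ 0 = 1" using A by (simp add: pos_log_deriv_def)
  have V0: "V 0 \<noteq> 0" using has_fps_expansion_imp_0_eq_fps_nth_0[OF exp] A0 by simp
  have "(- fps_X * fps_deriv A * inverse A) $ 1 = - A $ 1"
    by (simp add: mult.assoc fps_mult_nth_0 A0)
  then have "- A $ 1 \<in> \<real>\<^sub>\<ge>\<^sub>0" using A unfolding pos_log_deriv_def by metis
  then have a: "a > 0" using A1 by (auto simp: a_def complex_nonneg_Reals_iff complex_eq_iff)
  note mono = log_deriv_increment[OF hol exp A, folded T_def a_def]
  note bound = norm_log_deriv_le[OF hol exp A, folded T_def]
  have "\<exists>R r. (\<forall>z. norm z < R \<longrightarrow> V z \<noteq> 0) \<and> 0 < r \<and> r < R \<and> k \<le> Re (T (of_real r))"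
  proof (cases "\<exists>z. V z = 0")
    case False
    \<comment> \<open>Without zeros the linear lower bound with slope \<open>a\<close> reaches
      \<open>k\<close> at \<open>k / a\<close>; \<open>R\<close> only has to be larger.\<close>
    then have "a * (k / a - 0) \<le> Re (T (of_real (k / a))) - Re (T (of_real 0))"
      using a k by (intro mono[where R = "k / a + 1"]) auto
    with a k False show ?thesis
      by (intro exI[of _ "k / a + 1"] exI[of _ "k / a"]) (auto simp: T_def)
  next
    case True
    have "closed {z. V z = 0}"
      using continuous_closed_vimage[of "{0}" V] holomorphic_on_imp_continuous_on[OF hol]
      by (auto simp: vimage_def continuous_on_eq_continuous_at)
    \<comment> \<open>A zero of least modulus bounds the zero-free disc.\<close>
    with True obtain w where w: "V w = 0" "\<And>z. V z = 0 \<Longrightarrow> norm w \<le> norm z"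
      using distance_attains_inf[of "{z. V z = 0}" 0] by (auto simp: dist_norm)
    have nz: "V z \<noteq> 0" if "norm z < norm w" for z using w(2)[of z] that by auto
    have w0: "norm w > 0" using w(1) V0 by auto
    \<comment> \<open>If \<open>T\<close> stayed below \<open>k\<close> on the radius, domination
      would bound it on the whole disc, contradicting the zero \<open>w\<close> on the
      boundary.\<close>
    have "\<exists>r. 0 < r \<and> r < norm w \<and> k \<le> Re (T (of_real r))"
    proof (rule ccontr)
      assume "\<not> ?thesis"
      then have less: "Re (T (of_real r)) < k" if "0 < r" "r < norm w" for r
        using that by (meson not_le)
      show False
      proof (rule log_deriv_unbounded_at_zero[OF hol w0 refl w(1) _ nz])
        show "norm (z * deriv V z) \<le> k * norm (V z)" if z: "norm z < norm w" for z
        proof (cases "z = 0")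
          case False
          have "norm (T z) \<le> Re (T (of_real (norm z)))" by (rule bound[OF nz z]) auto
          also have "\<dots> < k" using False z by (intro less) auto
          finally show ?thesis using nz[OF z] by (simp add: T_def norm_divide divide_simps)
        qed (use k in simp)
      qed
    qed
    with nz show ?thesis by blast
  qed
  then obtain R r where R: "\<And>z. norm z < R \<Longrightarrow> V z \<noteq> 0" and r: "0 < r" "r < R" "k \<le> Re (T (of_real r))"
    by blast
  have "continuous_on {0..r} (\<lambda>t. Re (T (of_real t)))"
    unfolding T_def using R r
    by (intro continuous_intros continuous_on_compose2[OF holomorphic_on_imp_continuous_on[OF hol]]
        continuous_on_compose2[OF holomorphic_on_imp_continuous_on[OF holomorphic_deriv[OF hol open_UNIV]]])
      auto
  moreover have "Re (T (of_real 0)) \<le> k" using k by (simp add: T_def)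
  ultimately obtain x where x: "0 \<le> x" "x \<le> r" "Re (T (of_real x)) = k"
    using IVT'[of "\<lambda>t. Re (T (of_real t))" 0 k r] r by auto
  have x0: "x > 0" using x k by (cases "x = 0") (auto simp: T_def)
  have xR: "x < R" using x r by simp
  have "T (of_real x) \<in> \<real>\<^sub>\<ge>\<^sub>0"
    using log_deriv_nonneg[OF hol exp A R xR] x unfolding T_def by simp
  then have "T (of_real x) = of_real k"
    using x by (auto simp: complex_nonneg_Reals_iff complex_eq_iff)
  moreover have "Re (T z) < k" if z: "z \<in> ball 0 x" for z
  proof -
    have zx: "norm z < x" using z by simp
    have "Re (T z) \<le> norm (T z)" by (rule complex_Re_le_cmod)
    also have "\<dots> \<le> Re (T (of_real (norm z)))" by (rule bound[OF R]) (use zx xR in auto)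
    also have "\<dots> < Re (T (of_real x))"
    proof -
      have "a * (x - norm z) \<le> Re (T (of_real x)) - Re (T (of_real (norm z)))"
        using zx xR by (intro mono[OF R]) auto
      moreover have "a * (x - norm z) > 0" using a zx by simp
      ultimately show ?thesis by linarith
    qed
    finally show ?thesis using x by simp
  qed
  moreover have "V z \<noteq> 0" if "z \<in> cball 0 x" for z using that xR by (intro R) simp
  ultimately show ?thesis using x0 unfolding T_def by blast
qed

section \<open>Radius of starlikeness\<close>

text \<open>For the continuation \<open>F\<close> of the germ,
  \<open>z F' / F = 1 + z V' / (b V)\<close>, whose real part exceeds \<open>\<alpha>\<close>
  exactly when that of \<open>- z V' / V\<close> is below \<open>b (1 - \<alpha>)\<close>. This
  holds up to radius \<open>x\<close> and fails at the point \<open>x\<close> for every continuation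
  beyond it.\<close>

lemma starlike_radius_powr:
  fixes V :: "complex \<Rightarrow> complex"
  assumes hol: "V holomorphic_on UNIV" and V0: "V 0 = 1" and b: "b > 0" and x: "x > 0"
    and \<alpha>: "0 \<le> \<alpha>" "\<alpha> < 1"
    and nz: "\<And>z. z \<in> cball 0 x \<Longrightarrow> V z \<noteq> 0"
    and less: "\<And>z. z \<in> ball 0 x \<Longrightarrow> Re (- z * deriv V z / V z) < b * (1 - \<alpha>)"
    and eq: "- of_real x * deriv V (of_real x) / V (of_real x) = of_real (b * (1 - \<alpha>))"
  shows "starlike_radius \<alpha> (\<lambda>z. z * V z powr of_real (1 / b)) = ereal x"
proof -
  let ?f = "\<lambda>z. z * V z powr of_real (1 / b)"
  have hol': "deriv V holomorphic_on UNIV" by (rule holomorphic_deriv[OF hol open_UNIV])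
  have holS: "V holomorphic_on S" "deriv V holomorphic_on S" for S
    using hol hol' holomorphic_on_subset by blast+
  obtain L0 where L0: "L0 holomorphic_on ball 0 x" "\<And>z. z \<in> ball 0 x \<Longrightarrow> exp (L0 z) = V z"
    using holomorphic_logarithm_exists[OF convex_ball open_ball holS(1), of 0 x 0] nz x
    by (metis ball_subset_cball centre_in_ball subsetD)
  \<comment> \<open>The logarithm with value 0 at the origin, which selects the branch of the power
    with value 1 there.\<close>
  define L where "L z = L0 z - L0 0" for z
  have holL: "L holomorphic_on ball 0 x" unfolding L_def by (intro holomorphic_intros L0)
  have expL: "exp (L z) = V z" if "z \<in> ball 0 x" for z
    using L0(2)[OF that] L0(2)[of 0] x V0 by (simp add: L_def exp_diff)
  define F where "F z = z * exp (L z / of_real b)" for z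
  have holF: "F holomorphic_on ball 0 x" unfolding F_def by (intro holomorphic_intros holL) (use b in auto)
  have germ: "\<forall>\<^sub>F z in nhds 0. F z = ?f z"
  proof -
    have "continuous (at 0) L"
      using holomorphic_on_imp_continuous_on[OF holL] x
      by (simp add: continuous_on_eq_continuous_at)
    then have "(\<lambda>z. Im (L z)) \<midarrow>0\<rightarrow> Im (L 0)" by (auto simp: continuous_at intro: tendsto_intros)
    then have "((\<lambda>z. Im (L z)) \<longlongrightarrow> Im (L 0)) (nhds 0)"
      using tendsto_at_iff_tendsto_nhds[of "\<lambda>z. Im (L z)" 0] by simp
    then have lim: "((\<lambda>z. Im (L z)) \<longlongrightarrow> 0) (nhds 0)" by (simp add: L_def)
    have "\<forall>\<^sub>F z in nhds 0. z \<in> ball 0 x" using x by (intro eventually_nhds_in_open) auto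
    \<comment> \<open>Near 0 the imaginary part of \<open>L\<close> lies in the principal strip, so
      \<open>L\<close> agrees with \<open>Ln\<close> of \<open>V\<close>.\<close>
    moreover have "\<forall>\<^sub>F z in nhds 0. - pi < Im (L z)" "\<forall>\<^sub>F z in nhds 0. Im (L z) < pi"
      using lim by (auto intro!: order_tendstoD)
    ultimately show ?thesis
    proof eventually_elim
      case (elim z)
      then have "Ln (V z) = L z" unfolding expL[OF elim(1), symmetric] by (intro Ln_exp) auto
      moreover have "V z \<noteq> 0" using elim nz by auto
      ultimately show ?case by (simp add: F_def powr_def)
    qed
  qed
  \<comment> \<open>The formula for \<open>z F' / F\<close> with denominators cleared, so that it
    can be extended by continuity.\<close>
  have ode: "z * deriv F z * of_real b * V z = F z * (of_real b * V z + z * deriv V z)"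
    if z: "z \<in> ball 0 x" for z
  proof -
    have dL: "(L has_field_derivative deriv L z) (at z)"
      by (rule holomorphic_derivI[OF holL open_ball z])
    have "(F has_field_derivative
        (exp (L z / of_real b) + z * (exp (L z / of_real b) * (deriv L z / of_real b)))) (at z)"
      unfolding F_def using b by (auto intro!: derivative_eq_intros dL)
    then have F': "deriv F z = exp (L z / of_real b) + z * (exp (L z / of_real b) * (deriv L z / of_real b))"
      by (rule DERIV_imp_deriv)
    have "((\<lambda>w. exp (L w)) has_field_derivative exp (L z) * deriv L z) (at z)"
      by (auto intro!: derivative_eq_intros dL)
    then have "(V has_field_derivative exp (L z) * deriv L z) (at z)"
      by (rule has_field_derivative_transform_within_open[OF _ open_ball z expL])
    then have V': "deriv V z = V z * deriv L z" unfolding expL[OF z] by (rule DERIV_imp_deriv)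
    show ?thesis unfolding F' V' F_def using b by (simp add: field_simps)
  qed
  have quot: "Re (starlike_quot F z) > \<alpha>" if z: "z \<in> ball 0 x" for z
  proof (cases "z = 0")
    case True
    then show ?thesis using \<alpha> by (simp add: starlike_quot_def)
  next
    case False
    have "V z \<noteq> 0" using z nz by auto
    moreover have "F z \<noteq> 0" using False by (simp add: F_def)
    ultimately have "starlike_quot F z = 1 - (- z * deriv V z / V z) / of_real b"
      using ode[OF z] b False by (simp add: starlike_quot_def field_simps)
    then have "Re (starlike_quot F z) = 1 - Re (- z * deriv V z / V z) / b"
      by (simp only: minus_complex.sel one_complex.sel Re_divide_of_real)
    also have "\<dots> > \<alpha>" using less[OF z] b by (simp add: field_simps)
    finally show ?thesis .
  qed
  have upper: "r \<le> x" if r: "G holomorphic_on ball 0 r" "\<forall>\<^sub>F z in nhds 0. G z = ?f z"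
    "\<forall>z\<in>ball 0 r. Re (starlike_quot G z) > \<alpha>" for G r
  proof (rule ccontr)
    assume "\<not> r \<le> x"
    then have xr: "x < r" by simp
    have "\<forall>\<^sub>F z in nhds 0. G z = F z" using r(2) germ by eventually_elim simp
    then obtain S where S: "open S" "0 \<in> S" "\<And>z. z \<in> S \<Longrightarrow> G z = F z"
      unfolding eventually_nhds by blast
    have holG: "G holomorphic_on ball 0 x" by (rule holomorphic_on_subset[OF r(1)]) (use xr in auto)
    have ne: "S \<inter> ball 0 x \<noteq> {}" using S(2) x by (metis IntI centre_in_ball empty_iff)
    have GF: "G z = F z" if "z \<in> ball 0 x" for z
      by (rule analytic_continuation_open[OF open_Int[OF S(1) open_ball] open_ball ne
            connected_ball Int_lower2 holG holF _ that]) (simp add: S(3))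
    have GF': "deriv G z = deriv F z" if z: "z \<in> ball 0 x" for z
      using eventually_nhds_in_open[OF open_ball z]
      by (intro deriv_cong_ev refl) (auto elim!: eventually_mono simp: GF)
    \<comment> \<open>The differential equation of \<open>F\<close> persists for \<open>G\<close> up to the boundary point \<open>x\<close>, where
      \<open>F\<close> itself is not defined.\<close>
    define H where "H z = z * deriv G z * of_real b * V z - G z * (of_real b * V z + z * deriv V z)" for z
    have "H holomorphic_on ball 0 r"
      unfolding H_def by (intro holomorphic_intros holS r(1) holomorphic_deriv[OF r(1)]) auto
    then have "continuous_on (ball 0 r) H" by (rule holomorphic_on_imp_continuous_on)
    then have "continuous_on (closure (ball 0 x)) H"
      by (rule continuous_on_subset) (use x xr in auto)
    then have "H (of_real x) = 0"
      by (rule continuous_constant_on_closure[where S = "ball 0 x"])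
        (use ode x in \<open>auto simp: H_def GF GF'\<close>)
    moreover have Vx: "V (of_real x) \<noteq> 0" using nz x by auto
    moreover have "of_real x * deriv V (of_real x) = - of_real (b * (1 - \<alpha>)) * V (of_real x)"
      using eq Vx by (simp add: field_simps)
    ultimately have "(of_real b * V (of_real x)) * (of_real x * deriv G (of_real x) - of_real \<alpha> * G (of_real x)) = 0"
      by (simp add: H_def algebra_simps)
    then have "of_real x * deriv G (of_real x) = of_real \<alpha> * G (of_real x)"
      using Vx b by simp
    \<comment> \<open>If \<open>G\<close> is nonzero at \<open>x\<close> the quotient equals
      \<open>\<alpha>\<close>; otherwise division by zero gives 0, which is at most
      \<open>\<alpha>\<close>.\<close>
    then have "Re (starlike_quot G (of_real x)) \<le> \<alpha>"
      using x \<alpha> by (simp add: starlike_quot_def)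
    with r(3) x xr show False by (auto simp: not_less[symmetric])
  qed
  show ?thesis
    unfolding starlike_radius_def
  proof (rule Sup_eqI)
    show "y \<le> ereal x" if "y \<in> ereal ` {r. r > 0 \<and>
       (\<exists>G. G holomorphic_on ball 0 r \<and> (\<forall>\<^sub>F z in nhds 0. G z = ?f z) \<and>
            (\<forall>z\<in>ball 0 r. Re (starlike_quot G z) > \<alpha>))}" for y
      using that upper by auto
    show "ereal x \<le> y" if "\<And>w. w \<in> ereal ` {r. r > 0 \<and>
       (\<exists>G. G holomorphic_on ball 0 r \<and> (\<forall>\<^sub>F z in nhds 0. G z = ?f z) \<and>
            (\<forall>z\<in>ball 0 r. Re (starlike_quot G z) > \<alpha>))} \<Longrightarrow> w \<le> y" for y
      using x holF germ quot by (intro that imageI CollectI conjI exI[of _ F]) auto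
  qed
qed

text \<open>\<open>E r\<close> is \<open>c * V r\<close> times the difference of \<open>k\<close>
  and \<open>- r V' / V\<close>, so on \<open>(0, x]\<close> it vanishes exactly where the level
  \<open>k\<close> is attained. The factor \<open>c\<close> absorbs normalizing constants.\<close>

lemma smallest_pos_zero_log_deriv:
  fixes V :: "complex \<Rightarrow> complex"
  assumes x: "x > 0" and c: "c \<noteq> 0"
    and nz: "\<And>z. z \<in> cball 0 x \<Longrightarrow> V z \<noteq> 0"
    and less: "\<And>z. z \<in> ball 0 x \<Longrightarrow> Re (- z * deriv V z / V z) < k"
    and eq: "- of_real x * deriv V (of_real x) / V (of_real x) = of_real k"
    and E: "\<And>r. r > 0 \<Longrightarrow> E r = c * (of_real r * deriv V (of_real r) + of_real k * V (of_real r))"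
  shows "smallest_pos_zero E x"
proof -
  have *: "E r = 0 \<longleftrightarrow> - of_real r * deriv V (of_real r) / V (of_real r) = of_real k"
    if r: "0 < r" "r \<le> x" for r
  proof -
    have "V (of_real r) \<noteq> 0" using r by (intro nz) simp
    then have "- of_real r * deriv V (of_real r) / V (of_real r) = of_real k \<longleftrightarrow>
        - of_real r * deriv V (of_real r) = of_real k * V (of_real r)"
      by (subst divide_eq_eq) simp
    moreover have "E r = 0 \<longleftrightarrow> of_real r * deriv V (of_real r) + of_real k * V (of_real r) = 0"
      using c by (simp add: E[OF r(1)])
    ultimately show ?thesis by (simp only: mult_minus_left eq_neg_iff_add_eq_0 neg_eq_iff_add_eq_0)
  qed
  have "E r \<noteq> 0" if r: "0 < r" "r < x" for r
  proof
    assume "E r = 0"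
    then have "- of_real r * deriv V (of_real r) / V (of_real r) = of_real k" using * r by simp
    then have "Re (- of_real r * deriv V (of_real r) / V (of_real r)) = k" by (simp only: Re_complex_of_real)
    with less[of "of_real r"] r show False by simp
  qed
  with x *[of x] eq show ?thesis by (simp add: smallest_pos_zero_def)
qed

lemma has_field_derivative_comp_power2:
  assumes "W holomorphic_on UNIV"
  shows "((\<lambda>z. W (z\<^sup>2)) has_field_derivative 2 * z * deriv W (z\<^sup>2)) (at z)"
proof -
  have "((\<lambda>z. W (z\<^sup>2)) has_field_derivative deriv W (z\<^sup>2) * (2 * z)) (at z)"
    by (rule DERIV_chain2[OF holomorphic_derivI[OF assms]]) (auto intro!: derivative_eq_intros)
  then show ?thesis by (simp add: mult.commute)
qed

text \<open>Substituting the square doubles the logarithmic derivative: level \<open>k\<close> for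
  \<open>V\<close> is level \<open>k / 2\<close> for \<open>W\<close>, and the level point becomes
  its square root.\<close>

lemma ex_log_deriv_level_square:
  assumes hol: "W holomorphic_on UNIV" and exp: "W has_fps_expansion A" and A: "pos_log_deriv A"
    and A1: "A $ 1 \<noteq> 0" and k: "k > 0"
  defines "V \<equiv> \<lambda>z. W (z\<^sup>2)"
  shows "\<exists>x>0. (\<forall>z\<in>cball 0 x. V z \<noteq> 0) \<and>
           - of_real x * deriv V (of_real x) / V (of_real x) = of_real k \<and>
           (\<forall>z\<in>ball 0 x. Re (- z * deriv V z / V z) < k)"
proof -
  have "(V has_field_derivative 2 * z * deriv W (z\<^sup>2)) (at z)" for z
    unfolding V_def by (rule has_field_derivative_comp_power2[OF hol])
  then have "deriv V z = 2 * z * deriv W (z\<^sup>2)" for z by (rule DERIV_imp_deriv)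
  then have V': "- z * deriv V z / V z = of_real 2 * (- (z\<^sup>2) * deriv W (z\<^sup>2) / W (z\<^sup>2))" for z
    by (simp add: V_def power2_eq_square)
  obtain y where y: "y > 0" "\<And>z. z \<in> cball 0 y \<Longrightarrow> W z \<noteq> 0"
    "- of_real y * deriv W (of_real y) / W (of_real y) = of_real (k / 2)"
    "\<And>z. z \<in> ball 0 y \<Longrightarrow> Re (- z * deriv W z / W z) < k / 2"
    using ex_log_deriv_level[OF hol exp A A1 half_gt_zero[OF k]] by blast
  have sq: "norm (z\<^sup>2) \<le> y \<longleftrightarrow> norm z \<le> sqrt y" "norm (z\<^sup>2) < y \<longleftrightarrow> norm z < sqrt y" for z :: complex
  proof -
    have y2: "(sqrt y)\<^sup>2 = y" "sqrt y \<ge> 0" using y(1) by simp_all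
    show "norm (z\<^sup>2) \<le> y \<longleftrightarrow> norm z \<le> sqrt y"
      using power_mono_iff[of "norm z" "sqrt y" 2] y2 by (simp add: norm_power)
    show "norm (z\<^sup>2) < y \<longleftrightarrow> norm z < sqrt y"
      using power_mono_iff[of "sqrt y" "norm z" 2] y2 by (simp add: norm_power flip: not_le)
  qed
  show ?thesis
  proof (intro exI[of _ "sqrt y"] conjI ballI)
    show "sqrt y > 0" using y by simp
    show "V z \<noteq> 0" if "z \<in> cball 0 (sqrt y)" for z
      using that y(2)[of "z\<^sup>2"] by (simp add: V_def sq)
    have "(of_real (sqrt y))\<^sup>2 = complex_of_real y"
      using y(1) by (simp flip: of_real_power)
    then show "- of_real (sqrt y) * deriv V (of_real (sqrt y)) / V (of_real (sqrt y)) = of_real k"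
      by (simp only: V' y(3) flip: of_real_mult) simp
    show "Re (- z * deriv V z / V z) < k" if "z \<in> ball 0 (sqrt y)" for z
    proof -
      have "Re (- (z\<^sup>2) * deriv W (z\<^sup>2) / W (z\<^sup>2)) < k / 2" using that by (intro y(4)) (simp add: sq)
      then have "2 * Re (- (z\<^sup>2) * deriv W (z\<^sup>2) / W (z\<^sup>2)) < k" by linarith
      moreover have "Re (of_real 2 * u) = 2 * Re u" for u by simp
      ultimately show ?thesis unfolding V' by (simp only:)
    qed
  qed
qed

section \<open>The Wright series as an entire function\<close>

definition wright_fps :: "real \<Rightarrow> real \<Rightarrow> complex fps" where
  "wright_fps \<rho> \<beta> = Abs_fps (\<lambda>n. (- 1) ^ n / fact n * of_real (Gamma \<beta> / Gamma (real n * \<rho> + \<beta>)))"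

text \<open>Gamma is increasing beyond \<open>3 / 2\<close>, so the terms are eventually dominated
  by a constant multiple of the exponential series.\<close>

lemma summable_wright:
  assumes \<rho>: "\<rho> > 0"
  shows "summable (\<lambda>n. z ^ n / (fact n * complex_of_real (Gamma (real n * \<rho> + \<beta>))))"
proof (rule summable_comparison_test_ev)
  have "\<forall>\<^sub>F n in sequentially. (3 / 2 - \<beta>) / \<rho> < real n"
    by (rule filterlim_at_top_dense[THEN iffD1, OF filterlim_real_sequentially, rule_format])
  then have "\<forall>\<^sub>F n in sequentially. real n * \<rho> + \<beta> > 3 / 2"
    by eventually_elim (use \<rho> in \<open>simp add: pos_divide_less_eq\<close>)
  then show "\<forall>\<^sub>F n in sequentially. norm (z ^ n / (fact n * complex_of_real (Gamma (real n * \<rho> + \<beta>))))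
      \<le> (1 / Gamma (3 / 2)) * (norm z ^ n /\<^sub>R fact n)"
  proof eventually_elim
    case (elim n)
    have G: "0 < Gamma (3 / 2 :: real)" "Gamma (3 / 2) < Gamma (real n * \<rho> + \<beta>)"
      using elim by (simp_all only: Gamma_real_pos Gamma_real_strict_mono order_refl)
    have "norm (z ^ n / (fact n * complex_of_real (Gamma (real n * \<rho> + \<beta>)))) =
        norm z ^ n / fact n / Gamma (real n * \<rho> + \<beta>)"
      using less_trans[OF G] by (simp only: norm_divide norm_mult norm_power norm_of_real norm_fact
          abs_of_pos divide_divide_eq_left)
    also have "\<dots> \<le> norm z ^ n / fact n / Gamma (3 / 2)"
      by (rule divide_left_mono[OF less_imp_le[OF G(2)] _ mult_pos_pos[OF less_trans[OF G] G(1)]])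
        (intro divide_nonneg_nonneg zero_le_power norm_ge_zero fact_ge_zero)
    also have "\<dots> = (1 / Gamma (3 / 2)) * (norm z ^ n /\<^sub>R fact n)"
      by (simp only: divide_inverse real_scaleR_def mult_1 ac_simps)
    finally show ?case .
  qed
  show "summable (\<lambda>n. (1 / Gamma (3 / 2)) * (norm z ^ n /\<^sub>R fact n))"
    by (intro summable_mult summable_exp_generic)
qed

lemma
  assumes \<rho>: "\<rho> > 0"
  shows fps_conv_radius_wright: "fps_conv_radius (wright_fps \<rho> \<beta>) = \<infinity>"
    and eval_wright_fps: "eval_fps (wright_fps \<rho> \<beta>) z = of_real (Gamma \<beta>) * wright \<rho> \<beta> (- z)"
proof -
  have *: "fps_nth (wright_fps \<rho> \<beta>) n * z ^ n =
      of_real (Gamma \<beta>) * ((- z) ^ n / (fact n * complex_of_real (Gamma (real n * \<rho> + \<beta>))))" for n z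
    unfolding power_minus[of z] by (simp add: wright_fps_def)
  show "fps_conv_radius (wright_fps \<rho> \<beta>) = \<infinity>"
    unfolding fps_conv_radius_def
    by (rule conv_radius_inftyI'') (unfold *, intro summable_mult summable_wright \<rho>)
  show "eval_fps (wright_fps \<rho> \<beta>) z = of_real (Gamma \<beta>) * wright \<rho> \<beta> (- z)"
    unfolding eval_fps_def wright_def * by (rule suminf_mult[OF summable_wright[OF \<rho>]])
qed

theorem theorem1:
  fixes \<rho> \<beta> \<alpha> :: real
  assumes "\<rho> > 0" and "\<beta> > 0" and "0 \<le> \<alpha>" and "\<alpha> < 1"
  shows "(\<exists>x. smallest_pos_zero
               (\<lambda>r. of_real r * deriv (wright_lambda \<rho> \<beta>) (of_real r)
                    - of_real ((\<alpha> - 1) * \<beta>) * wright_lambda \<rho> \<beta> (of_real r)) x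
             \<and> starlike_radius \<alpha> (wright_f \<rho> \<beta>) = ereal x) \<and>
         (\<exists>y. smallest_pos_zero
               (\<lambda>r. of_real r * deriv (wright_lambda \<rho> \<beta>) (of_real r)
                    - of_real (\<alpha> - 1) * wright_lambda \<rho> \<beta> (of_real r)) y
             \<and> starlike_radius \<alpha> (wright_g \<rho> \<beta>) = ereal y) \<and>
         (\<exists>z. smallest_pos_zero
               (\<lambda>r. of_real (sqrt r) * deriv (wright_lambda \<rho> \<beta>) (of_real (sqrt r))
                    - of_real (2 * (\<alpha> - 1)) * wright_lambda \<rho> \<beta> (of_real (sqrt r))) z
             \<and> starlike_radius \<alpha> (wright_h \<rho> \<beta>) = ereal z)"
proof -
  define A where "A = wright_fps \<rho> \<beta>"
  define W where "W = eval_fps A"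
  define V where "V z = W (z\<^sup>2)" for z
  define c where "c = complex_of_real (1 / Gamma \<beta>)"
  have \<Gamma>: "Gamma \<beta> > 0" using assms by (intro Gamma_real_pos)
  have c: "c \<noteq> 0" using \<Gamma> by (simp add: c_def)
  have rad: "fps_conv_radius A = \<infinity>" unfolding A_def by (rule fps_conv_radius_wright[OF assms(1)])
  have W: "W z = of_real (Gamma \<beta>) * wright \<rho> \<beta> (- z)" for z
    unfolding W_def A_def by (rule eval_wright_fps[OF assms(1)])
  have hol: "W holomorphic_on UNIV" unfolding W_def by (rule holomorphic_on_eval_fps) (simp add: rad)
  have exp: "W has_fps_expansion A" unfolding W_def by (rule eval_fps_has_fps_expansion) (simp add: rad)
  have A: "pos_log_deriv A" unfolding A_def wright_fps_def by (rule pos_log_deriv_wright[OF assms(1,2)])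
  \<comment> \<open>The coefficient is
    \<open>- Gamma \<beta> / Gamma (\<rho> + \<beta>)\<close>.\<close>
  have A1: "A $ 1 \<noteq> 0"
  proof -
    have "Gamma (\<rho> + \<beta>) > 0" using assms by (intro Gamma_real_pos) simp
    with \<Gamma> have "Gamma \<beta> \<noteq> 0" "Gamma (\<rho> + \<beta>) \<noteq> 0" by (metis less_irrefl)+
    then show ?thesis by (simp add: A_def wright_fps_def)
  qed
  have W0: "W 0 = 1" using A by (simp add: W_def eval_fps_at_0 pos_log_deriv_def)
  have V': "(V has_field_derivative 2 * z * deriv W (z\<^sup>2)) (at z)" for z
    unfolding V_def by (rule has_field_derivative_comp_power2[OF hol])
  have holV: "V holomorphic_on UNIV"
    unfolding holomorphic_on_open[OF open_UNIV] using V' by blast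
  have lambda: "wright_lambda \<rho> \<beta> = (\<lambda>z. c * V z)"
    using \<Gamma> by (auto simp: wright_lambda_def V_def W c_def)
  have lambda': "deriv (wright_lambda \<rho> \<beta>) z = c * (2 * z * deriv W (z\<^sup>2))" for z
    unfolding lambda by (intro DERIV_imp_deriv DERIV_cmult V')
  have dV: "deriv V z = 2 * z * deriv W (z\<^sup>2)" for z by (rule DERIV_imp_deriv[OF V'])
  have f: "wright_f \<rho> \<beta> = (\<lambda>z. z * V z powr of_real (1 / \<beta>))"
    by (simp add: wright_f_def[abs_def] V_def W)
  \<comment> \<open>The exponent \<open>1 / 1\<close> puts \<open>g\<close> and \<open>h\<close>
    into the form of the power lemma with \<open>b = 1\<close>.\<close>
  have g: "wright_g \<rho> \<beta> = (\<lambda>z. z * V z powr of_real (1 / 1))"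
    by (simp add: wright_g_def[abs_def] V_def W mult_ac)
  have h: "wright_h \<rho> \<beta> = (\<lambda>z. z * W z powr of_real (1 / 1))"
    by (simp add: wright_h_def[abs_def] W mult_ac)
  \<comment> \<open>Taking \<open>b = \<beta>\<close> and \<open>b = 1\<close> gives the claims for
    \<open>f\<close> and \<open>g\<close>.\<close>
  have square: "\<exists>x. smallest_pos_zero
               (\<lambda>r. of_real r * deriv (wright_lambda \<rho> \<beta>) (of_real r)
                    - of_real ((\<alpha> - 1) * b) * wright_lambda \<rho> \<beta> (of_real r)) x
             \<and> starlike_radius \<alpha> (\<lambda>z. z * V z powr of_real (1 / b)) = ereal x" if b: "b > 0" for b
  proof -
    have pos: "b * (1 - \<alpha>) > 0" using b assms(4) by simp
    obtain x where x: "x > 0" "\<And>z. z \<in> cball 0 x \<Longrightarrow> V z \<noteq> 0"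
      "- of_real x * deriv V (of_real x) / V (of_real x) = of_real (b * (1 - \<alpha>))"
      "\<And>z. z \<in> ball 0 x \<Longrightarrow> Re (- z * deriv V z / V z) < b * (1 - \<alpha>)"
      using ex_log_deriv_level_square[OF hol exp A A1 pos] unfolding V_def by blast
    show ?thesis
    proof (intro exI conjI)
      show "starlike_radius \<alpha> (\<lambda>z. z * V z powr of_real (1 / b)) = ereal x"
        by (rule starlike_radius_powr[OF holV _ b x(1) assms(3,4) x(2,4,3)]) (simp_all add: V_def W0)
      show "smallest_pos_zero (\<lambda>r. of_real r * deriv (wright_lambda \<rho> \<beta>) (of_real r)
          - of_real ((\<alpha> - 1) * b) * wright_lambda \<rho> \<beta> (of_real r)) x"
      proof (rule smallest_pos_zero_log_deriv[OF x(1) c x(2,4,3)])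
        fix r :: real
        have "complex_of_real ((\<alpha> - 1) * b) = - of_real (b * (1 - \<alpha>))"
          by (simp add: algebra_simps)
        then show "of_real r * deriv (wright_lambda \<rho> \<beta>) (of_real r)
            - of_real ((\<alpha> - 1) * b) * wright_lambda \<rho> \<beta> (of_real r) =
            c * (of_real r * deriv V (of_real r) + of_real (b * (1 - \<alpha>)) * V (of_real r))"
          unfolding lambda' unfolding lambda dV by algebra
      qed
    qed
  qed
  \<comment> \<open>Here \<open>W\<close> itself is the relevant function: at \<open>sqrt r\<close>,
    \<open>\<lambda>\<close> equals \<open>c * W r\<close>, and \<open>sqrt r\<close> times its
    derivative equals \<open>2 c r W' r\<close>. This is the source of the factor 2 in the
    equation.\<close>
  have h_case: "\<exists>x. smallest_pos_zero
               (\<lambda>r. of_real (sqrt r) * deriv (wright_lambda \<rho> \<beta>) (of_real (sqrt r))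
                    - of_real (2 * (\<alpha> - 1)) * wright_lambda \<rho> \<beta> (of_real (sqrt r))) x
             \<and> starlike_radius \<alpha> (\<lambda>z. z * W z powr of_real (1 / 1)) = ereal x"
  proof -
    have pos: "1 * (1 - \<alpha>) > 0" using assms(4) by simp
    obtain x where x: "x > 0" "\<And>z. z \<in> cball 0 x \<Longrightarrow> W z \<noteq> 0"
      "- of_real x * deriv W (of_real x) / W (of_real x) = of_real (1 * (1 - \<alpha>))"
      "\<And>z. z \<in> ball 0 x \<Longrightarrow> Re (- z * deriv W z / W z) < 1 * (1 - \<alpha>)"
      using ex_log_deriv_level[OF hol exp A A1 pos] by blast
    have sq: "(of_real (sqrt r))\<^sup>2 = complex_of_real r" if "r > 0" for r
      using that by (simp flip: of_real_power)
    show ?thesis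
    proof (intro exI conjI)
      show "starlike_radius \<alpha> (\<lambda>z. z * W z powr of_real (1 / 1)) = ereal x"
        by (rule starlike_radius_powr[OF hol W0 zero_less_one x(1) assms(3,4) x(2,4,3)])
      show "smallest_pos_zero (\<lambda>r. of_real (sqrt r) * deriv (wright_lambda \<rho> \<beta>) (of_real (sqrt r))
          - of_real (2 * (\<alpha> - 1)) * wright_lambda \<rho> \<beta> (of_real (sqrt r))) x"
      proof (rule smallest_pos_zero_log_deriv[OF x(1) _ x(2,4,3)])
        show "2 * c \<noteq> 0" using c by simp
        fix r :: real assume r: "r > 0"
        have "of_real (sqrt r) * (c * (2 * of_real (sqrt r) * deriv W (of_real r))) =
            2 * c * ((of_real (sqrt r))\<^sup>2 * deriv W (of_real r))"
          by (simp add: power2_eq_square)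
        then show "of_real (sqrt r) * deriv (wright_lambda \<rho> \<beta>) (of_real (sqrt r))
          - of_real (2 * (\<alpha> - 1)) * wright_lambda \<rho> \<beta> (of_real (sqrt r)) =
          2 * c * (of_real r * deriv W (of_real r) + of_real (1 * (1 - \<alpha>)) * W (of_real r))"
          unfolding lambda' unfolding lambda V_def sq[OF r] by (simp add: algebra_simps)
      qed
    qed
  qed
  show ?thesis
    unfolding f g h using square[OF assms(2)] square[OF zero_less_one] h_case by simp
qed

end
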